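(* Let $Z$ be a topological space. The following statements are equivalent: (i) $Z$ is $T_{0}$, coherent and almost-sober. (ii) $Z$ is a Balbes-Dwinger space.
   Context: An irreducible closed set is a non-empty closed set $F$ such that $F=G\cup H$ with $G,H$ closed implies $F=G$ or $F=H$. A space $Z$ is almost-sober if every proper irreducible closed set (i.e. one different from $Z$) is the closure of some point. A space is coherent if it has a basis of open compact sets that is closed under finite (non-empty) intersections (compactness does not include Hausdorff). A lattice is a non-empty poset with binary joins and meets (neither a minimum nor a maximum is required). An ideal is a non-empty lower subset closed under finite non-empty joins. A proper ideal $I$ is prime if $a\wedge b\in I$ implies $a\in I$ or $b\in I$. The prime spectrum of a lattice $L$ is the set of its prime ideals with the topology whose basic open sets are $d(a)=\{I : I\text{ a prime ideal of }L,\ a\notin I\}$, $a\in L$. A Balbes-Dwinger space is a topological space homeomorphic to the prime spectrum of a distributive (not necessarily bounded) lattice. *)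

theory Defs
  imports "HOL-Algebra.Lattice" "HOL-Analysis.Analysis"
begin

definition irreducible_closedin :: "'a topology \<Rightarrow> 'a set \<Rightarrow> bool" where
  "irreducible_closedin Z F \<longleftrightarrow>
     F \<noteq> {} \<and> closedin Z F \<and>
     (\<forall>G H. closedin Z G \<and> closedin Z H \<and> F = G \<union> H \<longrightarrow> F = G \<or> F = H)"

definition almost_sober_space :: "'a topology \<Rightarrow> bool" where
  "almost_sober_space Z \<longleftrightarrow>
     (\<forall>F. irreducible_closedin Z F \<and> F \<noteq> topspace Z \<longrightarrow>
        (\<exists>x \<in> topspace Z. F = Z closure_of {x}))"

(* The empty intersection is excluded, so the space itself need not be compact. *)
definition coherent_space :: "'a topology \<Rightarrow> bool" where
  "coherent_space Z \<longleftrightarrow>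
     (\<exists>B. openin Z = arbitrary union_of (\<lambda>U. U \<in> B) \<and>
          (\<forall>U \<in> B. compactin Z U) \<and>
          (\<forall>\<F>. finite \<F> \<and> \<F> \<noteq> {} \<and> \<F> \<subseteq> B \<longrightarrow> \<Inter>\<F> \<in> B))"

locale distributive_lattice = lattice L for L (structure) +
  assumes carrier_nonempty: "carrier L \<noteq> {}"
    and meet_join_distrib:
      "\<lbrakk>x \<in> carrier L; y \<in> carrier L; z \<in> carrier L\<rbrakk>
         \<Longrightarrow> x \<sqinter> (y \<squnion> z) = (x \<sqinter> y) \<squnion> (x \<sqinter> z)"

definition lattice_ideal :: "('b, 'c) gorder_scheme \<Rightarrow> 'b set \<Rightarrow> bool" where
  "lattice_ideal L I \<longleftrightarrow>
     I \<subseteq> carrier L \<and> I \<noteq> {} \<and>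
     (\<forall>a \<in> I. \<forall>b \<in> carrier L. b \<sqsubseteq>\<^bsub>L\<^esub> a \<longrightarrow> b \<in> I) \<and>
     (\<forall>A. finite A \<and> A \<noteq> {} \<and> A \<subseteq> I \<longrightarrow> \<Squnion>\<^bsub>L\<^esub>A \<in> I)"

definition lattice_prime_ideal :: "('b, 'c) gorder_scheme \<Rightarrow> 'b set \<Rightarrow> bool" where
  "lattice_prime_ideal L I \<longleftrightarrow>
     lattice_ideal L I \<and> I \<noteq> carrier L \<and>
     (\<forall>a \<in> carrier L. \<forall>b \<in> carrier L. a \<sqinter>\<^bsub>L\<^esub> b \<in> I \<longrightarrow> a \<in> I \<or> b \<in> I)"

definition spectrum_basic :: "('b, 'c) gorder_scheme \<Rightarrow> 'b \<Rightarrow> 'b set set" where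
  "spectrum_basic L a = {I. lattice_prime_ideal L I \<and> a \<notin> I}"

definition prime_spectrum :: "('b, 'c) gorder_scheme \<Rightarrow> 'b set topology" where
  "prime_spectrum L = topology (arbitrary union_of (\<lambda>U. U \<in> spectrum_basic L ` carrier L))"

lemma spectrum_basic_Int:
  assumes "lattice L" "a \<in> carrier L" "b \<in> carrier L"
  shows "spectrum_basic L a \<inter> spectrum_basic L b = spectrum_basic L (a \<sqinter>\<^bsub>L\<^esub> b)"
proof -
  interpret lattice L by fact
  have "a \<in> I \<or> b \<in> I \<longleftrightarrow> a \<sqinter>\<^bsub>L\<^esub> b \<in> I" if I: "lattice_prime_ideal L I" for I
  proof
    have lower: "y \<in> I" if "x \<in> I" "y \<in> carrier L" "y \<sqsubseteq>\<^bsub>L\<^esub> x" for x y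
      using I that unfolding lattice_prime_ideal_def lattice_ideal_def by metis
    assume "a \<in> I \<or> b \<in> I"
    then show "a \<sqinter>\<^bsub>L\<^esub> b \<in> I"
      using lower[OF _ meet_closed[OF assms(2,3)]] meet_left[OF assms(2,3)] meet_right[OF assms(2,3)]
      by metis
  next
    assume "a \<sqinter>\<^bsub>L\<^esub> b \<in> I"
    then show "a \<in> I \<or> b \<in> I"
      using I assms(2,3) unfolding lattice_prime_ideal_def by metis
  qed
  then show ?thesis
    by (auto simp: spectrum_basic_def)
qed

lemma openin_prime_spectrum:
  assumes "lattice L"
  shows "openin (prime_spectrum L) = arbitrary union_of (\<lambda>U. U \<in> spectrum_basic L ` carrier L)"
proof -
  interpret lattice L by fact
  have "istopology (arbitrary union_of (\<lambda>U. U \<in> spectrum_basic L ` carrier L))"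
  proof (rule istopology_base)
    fix S T
    assume "S \<in> spectrum_basic L ` carrier L" "T \<in> spectrum_basic L ` carrier L"
    then obtain a b where "a \<in> carrier L" "S = spectrum_basic L a" "b \<in> carrier L" "T = spectrum_basic L b"
      by (elim imageE)
    then show "S \<inter> T \<in> spectrum_basic L ` carrier L"
      using spectrum_basic_Int[OF assms] meet_closed by (metis imageI)
  qed
  then show ?thesis
    by (simp add: prime_spectrum_def)
qed

lemma topspace_prime_spectrum:
  assumes "lattice L"
  shows "topspace (prime_spectrum L) = {I. lattice_prime_ideal L I}"
proof -
  have "topspace (prime_spectrum L) = \<Union>(spectrum_basic L ` carrier L)"
    unfolding topspace_def openin_prime_spectrum[OF assms]
    by (auto simp: union_of_def arbitrary_def)
  also have "\<dots> = {I. lattice_prime_ideal L I}"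
    by (auto simp: spectrum_basic_def lattice_prime_ideal_def lattice_ideal_def)
  finally show ?thesis .
qed

(* HOL has no quantifier over types, so the type in which the lattice lives is a parameter. *)
definition balbes_dwinger_space :: "'b itself \<Rightarrow> 'a topology \<Rightarrow> bool" where
  "balbes_dwinger_space TYPE('b) Z \<longleftrightarrow>
     (\<exists>L :: 'b gorder. distributive_lattice L \<and> Z homeomorphic_space prime_spectrum L)"

end

theory Submission
  imports Defs
begin

text \<open>
  For a distributive lattice, separating an ideal from an element outside it by a prime ideal
  (Zorn) makes every basic open set of the spectrum compact, and a proper irreducible
  closed set \<open>F\<close> is the closure of the prime ideal of all \<open>a\<close> whose basic open set misses \<open>F\<close>.
  Properness is needed only to make that ideal non-empty.

  Conversely, a \<open>T\<^sub>0\<close>, coherent, almost-sober space is recovered from its lattice of compact open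
  sets: a prime ideal \<open>I\<close> corresponds to the irreducible closed set \<open>F\<close> complementary to \<open>\<Union>I\<close>.
  The whole space arises as \<open>F\<close> exactly for \<open>I = {{}}\<close>, when that ideal is prime. If the space is
  irreducible without a generic point, this would be an additional point of the spectrum, so then
  the empty set is left out of the lattice; irreducibility makes the non-empty compact open sets
  closed under intersection.
\<close>

section \<open>Ideals of distributive lattices\<close>

text \<open>Binary joins suffice: by induction every finite subset of \<open>I\<close> has an upper
  bound in \<open>I\<close>, and the supremum of a non-empty one lies below that bound, hence in the
  lower set \<open>I\<close>. Later ideals are checked through this form.\<close>

lemma lattice_ideal_iff_join:
  fixes L :: "('b, 'c) gorder_scheme" (structure)
  assumes "lattice L"
  shows "lattice_ideal L I \<longleftrightarrow>
     I \<subseteq> carrier L \<and> I \<noteq> {} \<and>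
     (\<forall>a \<in> I. \<forall>b \<in> carrier L. b \<sqsubseteq> a \<longrightarrow> b \<in> I) \<and>
     (\<forall>a \<in> I. \<forall>b \<in> I. a \<squnion> b \<in> I)" (is "_ \<longleftrightarrow> ?R")
proof -
  interpret lattice L by fact
  show ?thesis
  proof
    assume I: "lattice_ideal L I"
    have "a \<squnion> b \<in> I" if "a \<in> I" "b \<in> I" for a b
    proof -
      have "finite {a, b} \<and> {a, b} \<noteq> {} \<and> {a, b} \<subseteq> I"
        using that by simp
      then show ?thesis
        using I unfolding lattice_ideal_def join_def by meson
    qed
    then show ?R
      using I unfolding lattice_ideal_def by auto
  next
    assume R: ?R
    \<comment> \<open>Allowing \<open>A = {}\<close>, where any element of the non-empty
      \<open>I\<close> is a bound, lets ordinary finite induction run.\<close>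
    have bound: "\<exists>u \<in> I. \<forall>a \<in> A. a \<sqsubseteq> u" if "finite A" "A \<subseteq> I" for A
      using that
    proof (induction A rule: finite_induct)
      case empty
      then show ?case using R by auto
    next
      case (insert x A)
      then obtain u where u: "u \<in> I" "\<And>a. a \<in> A \<Longrightarrow> a \<sqsubseteq> u" by auto
      have car: "x \<in> carrier L" "u \<in> carrier L" "A \<subseteq> carrier L"
        using insert R u by auto
      have "a \<sqsubseteq> x \<squnion> u" if a: "a \<in> insert x A" for a
      proof (cases "a = x")
        case True
        then show ?thesis using join_left car by simp
      next
        case False
        then have "a \<sqsubseteq> u" "a \<in> carrier L" using a u car by auto
        then show ?thesis
          using le_trans[OF _ join_right[OF car(1,2)]] car by simp
      qed
      moreover have "x \<squnion> u \<in> I"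
        using R insert.prems u by auto
      ultimately show ?case by (intro bexI[of _ "x \<squnion> u"] ballI)
    qed
    have "\<Squnion>A \<in> I" if A: "finite A" "A \<noteq> {}" "A \<subseteq> I" for A
    proof -
      obtain u where u: "u \<in> I" "\<And>a. a \<in> A \<Longrightarrow> a \<sqsubseteq> u"
        using bound[OF A(1,3)] by blast
      have car: "A \<subseteq> carrier L" using A R by auto
      have lub: "least L (\<Squnion>A) (Upper L A)"
        using finite_sup_least[OF A(1) car A(2)] .
      have "u \<in> Upper L A"
        using u R by (auto simp: Upper_def)
      then have "\<Squnion>A \<sqsubseteq> u"
        using least_le[OF lub] by simp
      then show ?thesis
        using R u(1) least_closed[OF lub] by blast
    qed
    then show "lattice_ideal L I"
      using R unfolding lattice_ideal_def by auto
  qed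
qed

text \<open>Zorn's lemma gives an ideal \<open>M\<close> that is maximal among those containing
  \<open>J\<close> and avoiding \<open>a\<close>. Maximality forces every ideal properly above
  \<open>M\<close> to contain \<open>a\<close>; distributivity then makes \<open>M\<close>
  prime.\<close>

lemma (in distributive_lattice) prime_ideal_separation:
  assumes J: "lattice_ideal L J" and a: "a \<in> carrier L" "a \<notin> J"
  obtains I where "lattice_prime_ideal L I" "J \<subseteq> I" "a \<notin> I"
proof -
  note ideal_iff = lattice_ideal_iff_join[OF lattice_axioms]
  define \<A> where "\<A> = {I. lattice_ideal L I \<and> J \<subseteq> I \<and> a \<notin> I}"
  have "\<exists>M \<in> \<A>. \<forall>X \<in> \<A>. M \<subseteq> X \<longrightarrow> X = M"
  proof (rule subset_Zorn_nonempty)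
    show "\<A> \<noteq> {}" using J a by (auto simp: \<A>_def)
  next
    fix \<C> assume \<C>: "\<C> \<noteq> {}" "subset.chain \<A> \<C>"
    then have sub: "\<C> \<subseteq> \<A>" and lin: "\<And>X Y. X \<in> \<C> \<Longrightarrow> Y \<in> \<C> \<Longrightarrow> X \<subseteq> Y \<or> Y \<subseteq> X"
      by (auto simp: subset_chain_def)
    have id: "I \<subseteq> carrier L" "I \<noteq> {}" "J \<subseteq> I" "a \<notin> I"
      "\<And>x y. x \<in> I \<Longrightarrow> y \<in> carrier L \<Longrightarrow> y \<sqsubseteq> x \<Longrightarrow> y \<in> I"
      "\<And>x y. x \<in> I \<Longrightarrow> y \<in> I \<Longrightarrow> x \<squnion> y \<in> I" if "I \<in> \<C>" for I
      using that sub by (auto simp: \<A>_def ideal_iff)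
    have "x \<squnion> y \<in> \<Union>\<C>" if xy: "x \<in> \<Union>\<C>" "y \<in> \<Union>\<C>" for x y
    proof -
      obtain X Y where "X \<in> \<C>" "Y \<in> \<C>" "x \<in> X" "y \<in> Y" using xy by blast
      then show ?thesis using lin[of X Y] id(6) by blast
    qed
    moreover have "\<Union>\<C> \<subseteq> carrier L" "\<Union>\<C> \<noteq> {}" "J \<subseteq> \<Union>\<C>" "a \<notin> \<Union>\<C>"
      using id(1-4) \<C>(1) by blast+
    moreover have "y \<in> \<Union>\<C>" if "x \<in> \<Union>\<C>" "y \<in> carrier L" "y \<sqsubseteq> x" for x y
      using that id(5) by blast
    ultimately show "\<Union>\<C> \<in> \<A>"
      unfolding \<A>_def ideal_iff by blast
  qed
  then obtain M where M: "M \<in> \<A>" and max: "\<And>X. X \<in> \<A> \<Longrightarrow> M \<subseteq> X \<Longrightarrow> X = M"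
    by blast
  have Mid: "lattice_ideal L M" "J \<subseteq> M" "a \<notin> M" using M by (auto simp: \<A>_def)
  have Mcar: "M \<subseteq> carrier L" and Mne: "M \<noteq> {}"
    and Mlow: "\<And>x y. x \<in> M \<Longrightarrow> y \<in> carrier L \<Longrightarrow> y \<sqsubseteq> x \<Longrightarrow> y \<in> M"
    and Mjoin: "\<And>x y. x \<in> M \<Longrightarrow> y \<in> M \<Longrightarrow> x \<squnion> y \<in> M"
    using Mid(1) by (auto simp: ideal_iff)
  have adjoin: "\<exists>k \<in> M. a \<sqsubseteq> k \<squnion> b" if b: "b \<in> carrier L" "b \<notin> M" for b
  proof (rule ccontr)
    assume neg: "\<not> ?thesis"
    \<comment> \<open>\<open>N\<close> is the ideal generated by \<open>M\<close> and
      \<open>b\<close>. If it avoided \<open>a\<close>, it would contradict the maximality of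
      \<open>M\<close>.\<close>
    define N where "N = {x \<in> carrier L. \<exists>k \<in> M. x \<sqsubseteq> k \<squnion> b}"
    have mem: "x \<in> N" if "x \<in> M" for x
      using that Mcar b join_left unfolding N_def by blast
    have "b \<in> N"
      using Mne Mcar b join_right unfolding N_def by blast
    have "x \<squnion> y \<in> N" if xy: "x \<in> N" "y \<in> N" for x y
    proof -
      obtain k l where kl: "k \<in> M" "l \<in> M" "x \<sqsubseteq> k \<squnion> b" "y \<sqsubseteq> l \<squnion> b"
        using xy by (auto simp: N_def)
      have car: "k \<in> carrier L" "l \<in> carrier L" "x \<in> carrier L" "y \<in> carrier L"
        using kl Mcar xy by (auto simp: N_def)
      let ?m = "k \<squnion> l"
      have m: "?m \<squnion> b \<in> carrier L" using car b by simp
      have bm: "b \<sqsubseteq> ?m \<squnion> b" using car b join_right by simp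
      have "k \<sqsubseteq> ?m \<squnion> b" "l \<sqsubseteq> ?m \<squnion> b"
        using car b by (meson join_closed join_left join_right le_trans)+
      then have "k \<squnion> b \<sqsubseteq> ?m \<squnion> b" "l \<squnion> b \<sqsubseteq> ?m \<squnion> b"
        using join_le bm car b m by blast+
      then have "x \<sqsubseteq> ?m \<squnion> b" "y \<sqsubseteq> ?m \<squnion> b"
        using kl car b m by (meson join_closed le_trans)+
      then have "x \<squnion> y \<sqsubseteq> ?m \<squnion> b"
        using join_le car m by blast
      moreover have "?m \<in> M" using Mjoin kl by blast
      ultimately show ?thesis
        using car by (auto simp: N_def)
    qed
    moreover have "y \<in> N" if xy: "x \<in> N" "y \<in> carrier L" "y \<sqsubseteq> x" for x y
    proof -
      obtain k where k: "k \<in> M" "x \<sqsubseteq> k \<squnion> b" "x \<in> carrier L"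
        using xy(1) unfolding N_def by blast
      then have "y \<sqsubseteq> k \<squnion> b"
        using xy(2,3) Mcar b by (meson join_closed le_trans subsetD)
      then show ?thesis using k xy by (auto simp: N_def)
    qed
    moreover have "N \<subseteq> carrier L" "N \<noteq> {}" "J \<subseteq> N" "a \<notin> N"
      using \<open>b \<in> N\<close> mem Mid(2) neg by (auto simp: N_def)
    ultimately have "N \<in> \<A>"
      unfolding \<A>_def ideal_iff by blast
    then have "N = M" using max mem by blast
    then show False using \<open>b \<in> N\<close> b by blast
  qed
  have "lattice_prime_ideal L M"
    unfolding lattice_prime_ideal_def
  proof (intro conjI ballI impI)
    show "lattice_ideal L M" "M \<noteq> carrier L" using Mid a by auto
  next
    fix b c assume bc: "b \<in> carrier L" "c \<in> carrier L" "b \<sqinter> c \<in> M"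
    show "b \<in> M \<or> c \<in> M"
    proof (rule ccontr)
      assume "\<not> ?thesis"
      \<comment> \<open>If neither \<open>b\<close> nor \<open>c\<close> lies in \<open>M\<close>,
        adjoining either one captures \<open>a\<close>. Distributing meets over both bounds then
        puts \<open>a\<close> itself into \<open>M\<close>.\<close>
      then have "\<exists>k \<in> M. a \<sqsubseteq> k \<squnion> b" "\<exists>k \<in> M. a \<sqsubseteq> k \<squnion> c"
        using adjoin[OF bc(1)] adjoin[OF bc(2)] by blast+
      then obtain k l where kl: "k \<in> M" "l \<in> M" "a \<sqsubseteq> k \<squnion> b" "a \<sqsubseteq> l \<squnion> c"
        by blast
      have car: "k \<in> carrier L" "l \<in> carrier L" using kl Mcar by auto
      \<comment> \<open>\<open>a = a \<sqinter> (k \<squnion> b) \<le> k \<squnion> (a \<sqinter> b)\<close> and \<open>a \<sqinter> b = (a \<sqinter> b) \<sqinter> (l \<squnion> c) \<le> l \<squnion> (b \<sqinter> c)\<close>, both in \<open>M\<close>\<close>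
      let ?ab = "a \<sqinter> b"
      have ab: "?ab \<in> carrier L" using a bc by simp
      have "?ab \<sqsubseteq> l \<squnion> c"
        using kl car a bc ab by (meson join_closed le_trans meet_left)
      then have "?ab = ?ab \<sqinter> (l \<squnion> c)"
        using le_iff_join[of ?ab "l \<squnion> c"] ab car bc by simp
      also have "\<dots> = (?ab \<sqinter> l) \<squnion> (?ab \<sqinter> c)"
        using meet_join_distrib ab car bc by simp
      finally have ab_eq: "?ab = (?ab \<sqinter> l) \<squnion> (?ab \<sqinter> c)" .
      have "?ab \<sqinter> l \<in> M"
        using Mlow[OF kl(2)] ab car by (simp add: meet_right)
      moreover have "?ab \<sqinter> c \<in> M"
      proof (rule Mlow[OF bc(3)])
        have "?ab \<sqinter> c \<sqsubseteq> b"
          using ab a bc by (meson le_trans meet_closed meet_left meet_right)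
        then show "?ab \<sqinter> c \<sqsubseteq> b \<sqinter> c"
          using ab bc by (simp add: meet_le meet_right)
        show "?ab \<sqinter> c \<in> carrier L" using ab bc by simp
      qed
      ultimately have abM: "?ab \<in> M"
        using ab_eq Mjoin by metis
      have "a = a \<sqinter> (k \<squnion> b)"
        using le_iff_join[of a "k \<squnion> b"] kl a car bc by simp
      also have "\<dots> = (a \<sqinter> k) \<squnion> ?ab"
        using meet_join_distrib a car bc by simp
      finally have "a = (a \<sqinter> k) \<squnion> ?ab" .
      moreover have "a \<sqinter> k \<in> M"
        using Mlow[OF kl(1)] a car by (simp add: meet_right)
      ultimately show False
        using abM Mjoin Mid(3) by metis
    qed
  qed
  with Mid show thesis using that by blast
qed

section \<open>The prime spectrum\<close>

lemma prime_ideal_carrier: "lattice_prime_ideal L I \<Longrightarrow> I \<subseteq> carrier L"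
  by (simp add: lattice_prime_ideal_def lattice_ideal_def)

lemma prime_ideal_lower:
  "lattice_prime_ideal L I \<Longrightarrow> a \<in> I \<Longrightarrow> b \<in> carrier L \<Longrightarrow> b \<sqsubseteq>\<^bsub>L\<^esub> a \<Longrightarrow> b \<in> I"
  unfolding lattice_prime_ideal_def lattice_ideal_def by blast

lemma (in lattice) prime_ideal_join_iff:
  assumes I: "lattice_prime_ideal L I" and ab: "a \<in> carrier L" "b \<in> carrier L"
  shows "a \<squnion> b \<in> I \<longleftrightarrow> a \<in> I \<and> b \<in> I"
proof
  show "a \<in> I \<and> b \<in> I" if "a \<squnion> b \<in> I"
    using prime_ideal_lower[OF I that] join_left[OF ab] join_right[OF ab] ab by blast
  show "a \<squnion> b \<in> I" if "a \<in> I \<and> b \<in> I"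
    using I that by (simp add: lattice_prime_ideal_def lattice_ideal_iff_join[OF lattice_axioms])
qed

lemma (in lattice) spectrum_basic_join:
  assumes "a \<in> carrier L" "b \<in> carrier L"
  shows "spectrum_basic L (a \<squnion> b) = spectrum_basic L a \<union> spectrum_basic L b"
proof (rule Set.set_eqI)
  fix I
  show "I \<in> spectrum_basic L (a \<squnion> b) \<longleftrightarrow> I \<in> spectrum_basic L a \<union> spectrum_basic L b"
    using prime_ideal_join_iff[OF _ assms, of I] unfolding spectrum_basic_def by blast
qed

lemma spectrum_basic_mono:
  assumes "a \<sqsubseteq>\<^bsub>L\<^esub> b" "a \<in> carrier L"
  shows "spectrum_basic L a \<subseteq> spectrum_basic L b"
  unfolding spectrum_basic_def using prime_ideal_lower[OF _ _ assms(2,1)] by blast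

lemma (in lattice) openin_spectrum_basic:
  assumes "a \<in> carrier L"
  shows "openin (prime_spectrum L) (spectrum_basic L a)"
  unfolding openin_prime_spectrum[OF lattice_axioms]
  using assms by (intro arbitrary_union_of_inc) simp

lemma (in lattice) prime_spectrum_baseE:
  assumes "openin (prime_spectrum L) U" "I \<in> U"
  obtains a where "a \<in> carrier L" "I \<in> spectrum_basic L a" "spectrum_basic L a \<subseteq> U"
proof -
  have "\<exists>V. V \<in> spectrum_basic L ` carrier L \<and> I \<in> V \<and> V \<subseteq> U"
    using openin_prime_spectrum[OF lattice_axioms, unfolded openin_topology_base_unique,
        THEN conjunct2, rule_format] assms by simp
  then show thesis using that by blast
qed

section \<open>Separation, compactness and almost-soberness of the spectrum\<close>

lemma (in lattice) t0_space_prime_spectrum: "t0_space (prime_spectrum L)"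
  unfolding t0_space_def topspace_prime_spectrum[OF lattice_axioms]
proof (intro ballI impI)
  fix I J assume IJ: "I \<in> {I. lattice_prime_ideal L I}" "J \<in> {I. lattice_prime_ideal L I}" "I \<noteq> J"
  then obtain a where "a \<in> carrier L" "a \<in> I \<longleftrightarrow> a \<notin> J"
    using prime_ideal_carrier by blast
  then show "\<exists>U. openin (prime_spectrum L) U \<and> (I \<notin> U) = (J \<in> U)"
    using IJ openin_spectrum_basic[of a]
    by (intro exI[of _ "spectrum_basic L a"] conjI) (simp_all add: spectrum_basic_def)
qed

text \<open>The elements whose basic open set is finitely covered form an ideal \<open>J\<close>. If
  \<open>a\<close> were not in \<open>J\<close>, a prime ideal containing \<open>J\<close> but not
  \<open>a\<close> would be a point of \<open>spectrum_basic L a\<close>. Some cover member contains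
  a basic neighbourhood of that point, whose index lies in \<open>J\<close> but not in the point, a
  contradiction.\<close>

lemma (in distributive_lattice) compactin_spectrum_basic:
  assumes a: "a \<in> carrier L"
  shows "compactin (prime_spectrum L) (spectrum_basic L a)"
  unfolding compactin_def
proof (intro conjI allI impI)
  show "spectrum_basic L a \<subseteq> topspace (prime_spectrum L)"
    using a openin_spectrum_basic openin_subset by blast
next
  fix \<U> assume "(\<forall>U \<in> \<U>. openin (prime_spectrum L) U) \<and> spectrum_basic L a \<subseteq> \<Union>\<U>"
  then have op: "\<And>U. U \<in> \<U> \<Longrightarrow> openin (prime_spectrum L) U" and cov: "spectrum_basic L a \<subseteq> \<Union>\<U>"
    by auto
  define J where "J = {c \<in> carrier L. \<exists>\<F>. finite \<F> \<and> \<F> \<subseteq> \<U> \<and> spectrum_basic L c \<subseteq> \<Union>\<F>}"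
  have meets: "\<exists>c \<in> J. c \<notin> I" if I: "I \<in> spectrum_basic L a" for I
  proof -
    obtain U where U: "U \<in> \<U>" "I \<in> U" using cov I by blast
    then obtain c where c: "c \<in> carrier L" "I \<in> spectrum_basic L c" "spectrum_basic L c \<subseteq> U"
      using prime_spectrum_baseE op by blast
    have "finite {U} \<and> {U} \<subseteq> \<U> \<and> spectrum_basic L c \<subseteq> \<Union>{U}" using U c by simp
    then have "c \<in> J" using c(1) unfolding J_def by blast
    then show ?thesis using c(2) by (auto simp: spectrum_basic_def)
  qed
  show "\<exists>\<F>. finite \<F> \<and> \<F> \<subseteq> \<U> \<and> spectrum_basic L a \<subseteq> \<Union>\<F>"
  proof (rule ccontr)
    assume neg: "\<not> ?thesis"
    then have aJ: "a \<notin> J" by (auto simp: J_def)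
    \<comment> \<open>Otherwise the empty subfamily would be a finite cover. Any point of this set
      supplies an element of \<open>J\<close>, which replaces the possibly absent minimum of the
      lattice.\<close>
    have "spectrum_basic L a \<noteq> {}" using neg by blast
    then have "J \<noteq> {}" using meets by blast
    moreover have "x \<squnion> y \<in> J" if xy: "x \<in> J" "y \<in> J" for x y
    proof -
      obtain \<F> \<G> where "finite \<F>" "\<F> \<subseteq> \<U>" "spectrum_basic L x \<subseteq> \<Union>\<F>"
        "finite \<G>" "\<G> \<subseteq> \<U>" "spectrum_basic L y \<subseteq> \<Union>\<G>"
        using xy unfolding J_def by blast
      then have "finite (\<F> \<union> \<G>) \<and> \<F> \<union> \<G> \<subseteq> \<U> \<and> spectrum_basic L (x \<squnion> y) \<subseteq> \<Union>(\<F> \<union> \<G>)"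
        using xy by (auto simp: J_def spectrum_basic_join)
      then have "\<exists>\<H>. finite \<H> \<and> \<H> \<subseteq> \<U> \<and> spectrum_basic L (x \<squnion> y) \<subseteq> \<Union>\<H>" by blast
      moreover have "x \<squnion> y \<in> carrier L" using xy by (simp add: J_def)
      ultimately show ?thesis unfolding J_def by simp
    qed
    moreover have "y \<in> J" if xy: "x \<in> J" "y \<in> carrier L" "y \<sqsubseteq> x" for x y
    proof -
      obtain \<F> where "finite \<F>" "\<F> \<subseteq> \<U>" "spectrum_basic L x \<subseteq> \<Union>\<F>"
        using xy(1) unfolding J_def by blast
      then have "\<exists>\<F>. finite \<F> \<and> \<F> \<subseteq> \<U> \<and> spectrum_basic L y \<subseteq> \<Union>\<F>"
        using spectrum_basic_mono[OF xy(3,2)] by blast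
      then show ?thesis using xy(2) unfolding J_def by simp
    qed
    ultimately have "lattice_ideal L J"
      unfolding lattice_ideal_iff_join[OF lattice_axioms] by (auto simp: J_def)
    then obtain I where "lattice_prime_ideal L I" "J \<subseteq> I" "a \<notin> I"
      using prime_ideal_separation a aJ by metis
    then show False using meets[of I] by (auto simp: spectrum_basic_def)
  qed
qed

lemma (in distributive_lattice) coherent_space_prime_spectrum: "coherent_space (prime_spectrum L)"
  unfolding coherent_space_def
proof (intro exI conjI allI impI)
  let ?B = "spectrum_basic L ` carrier L"
  show "openin (prime_spectrum L) = arbitrary union_of (\<lambda>U. U \<in> ?B)"
    by (rule openin_prime_spectrum[OF lattice_axioms])
  show "\<forall>U \<in> ?B. compactin (prime_spectrum L) U"
    using compactin_spectrum_basic by blast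
  fix \<F> assume "finite \<F> \<and> \<F> \<noteq> {} \<and> \<F> \<subseteq> ?B"
  then have "finite \<F>" "\<F> \<noteq> {}" "\<F> \<subseteq> ?B" by auto
  then show "\<Inter>\<F> \<in> ?B"
  proof (induction \<F> rule: finite_ne_induct)
    case (singleton U)
    then show ?case by simp
  next
    case (insert U \<F>)
    then obtain a b where "a \<in> carrier L" "U = spectrum_basic L a"
      "b \<in> carrier L" "\<Inter>\<F> = spectrum_basic L b" by auto
    then show ?case
      using spectrum_basic_Int[OF lattice_axioms] by simp
  qed
qed

lemma (in distributive_lattice) almost_sober_space_prime_spectrum:
  "almost_sober_space (prime_spectrum L)"
  unfolding almost_sober_space_def
proof (intro allI impI)
  let ?S = "prime_spectrum L" and ?d = "spectrum_basic L"
  fix F assume "irreducible_closedin ?S F \<and> F \<noteq> topspace ?S"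
  then have Fne: "F \<noteq> {}" and Fcl: "closedin ?S F" and Fprop: "F \<noteq> topspace ?S"
    and Firr: "\<And>G H. closedin ?S G \<Longrightarrow> closedin ?S H \<Longrightarrow> F = G \<union> H \<Longrightarrow> F = G \<or> F = H"
    by (auto simp: irreducible_closedin_def)
  note tops = topspace_prime_spectrum[OF lattice_axioms]
  have Fsub: "F \<subseteq> topspace ?S" using Fcl closedin_subset by blast
  have comp: "openin ?S (topspace ?S - F)" using Fcl by (simp add: closedin_def)
  define I where "I = {a \<in> carrier L. ?d a \<inter> F = {}}"
  \<comment> \<open>This serves twice. A point outside \<open>F\<close> yields an element of
    \<open>I\<close>, so \<open>I\<close> is non-empty. Taking \<open>P = I\<close> would yield an
    element of \<open>I\<close> outside \<open>I\<close>, so \<open>I\<close> must lie in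
    \<open>F\<close>.\<close>
  have out: "\<exists>a \<in> I. a \<notin> P" if "P \<in> topspace ?S" "P \<notin> F" for P
  proof -
    have "P \<in> topspace ?S - F" using that by blast
    then obtain a where "a \<in> carrier L" "P \<in> ?d a" "?d a \<subseteq> topspace ?S - F"
      using prime_spectrum_baseE comp by blast
    then show ?thesis by (auto simp: I_def spectrum_basic_def)
  qed
  have prime: "lattice_prime_ideal L I"
    unfolding lattice_prime_ideal_def lattice_ideal_iff_join[OF lattice_axioms]
  proof (intro conjI ballI impI)
    show "I \<subseteq> carrier L" by (auto simp: I_def)
    show "I \<noteq> {}" using out Fprop Fsub by blast
    show "y \<in> I" if "x \<in> I" "y \<in> carrier L" "y \<sqsubseteq> x" for x y
      using that spectrum_basic_mono[of L y x] by (auto simp: I_def)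
    show "x \<squnion> y \<in> I" if "x \<in> I" "y \<in> I" for x y
      using that by (auto simp: I_def spectrum_basic_join)
    obtain P where P: "P \<in> F" "lattice_prime_ideal L P" using Fne Fsub tops by auto
    then have "P \<noteq> carrier L" "P \<subseteq> carrier L"
      using prime_ideal_carrier by (auto simp: lattice_prime_ideal_def)
    then obtain a where "a \<in> carrier L" "a \<notin> P" by blast
    then show "I \<noteq> carrier L" using P by (auto simp: I_def spectrum_basic_def)
    fix a b assume ab: "a \<in> carrier L" "b \<in> carrier L" "a \<sqinter> b \<in> I"
    have "?d a \<inter> ?d b \<inter> F = {}"
      using ab spectrum_basic_Int[OF lattice_axioms ab(1,2)] by (simp add: I_def)
    \<comment> \<open>Irreducibility of \<open>F\<close> becomes primeness of \<open>I\<close>: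
      whichever piece equals \<open>F\<close> shows that the corresponding basic open set misses
      \<open>F\<close>.\<close>
    then have "F = (F - ?d a) \<union> (F - ?d b)" by blast
    moreover have "closedin ?S (F - ?d a)" "closedin ?S (F - ?d b)"
      using ab Fcl openin_spectrum_basic by auto
    ultimately have "F = F - ?d a \<or> F = F - ?d b" using Firr by blast
    then show "a \<in> I \<or> b \<in> I" using ab by (auto simp: I_def)
  qed
  have IS: "I \<in> topspace ?S" using prime tops by simp
  have "I \<in> F" using out[OF IS] by blast
  then have "?S closure_of {I} \<subseteq> F" using Fcl by (simp add: closure_of_minimal)
  moreover have "P \<in> ?S closure_of {I}" if P: "P \<in> F" for P
    unfolding in_closure_of
  proof (intro conjI allI impI)
    show "P \<in> topspace ?S" using P Fsub by blast
    fix T assume "P \<in> T \<and> openin ?S T"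
    then obtain a where a: "a \<in> carrier L" "P \<in> ?d a" "?d a \<subseteq> T"
      using prime_spectrum_baseE by metis
    \<comment> \<open>The set \<open>?d a\<close> meets \<open>F\<close> in \<open>P\<close>, so
      \<open>a\<close> lies outside \<open>I\<close>, which says exactly that the point
      \<open>I\<close> is in \<open>?d a\<close>.\<close>
    then have "a \<notin> I" using P by (auto simp: I_def)
    then have "I \<in> ?d a" using prime by (simp add: spectrum_basic_def)
    then show "\<exists>y. y \<in> {I} \<and> y \<in> T" using a by blast
  qed
  ultimately show "\<exists>x \<in> topspace ?S. F = ?S closure_of {x}" using IS by blast
qed

section \<open>Invariance under homeomorphism\<close>

lemma homeomorphic_map_coherent_space:
  assumes f: "homeomorphic_map X Y f" and X: "coherent_space X"
  shows "coherent_space Y"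
proof -
  obtain B where base: "openin X = arbitrary union_of (\<lambda>U. U \<in> B)"
    and comp: "\<And>U. U \<in> B \<Longrightarrow> compactin X U"
    and Int: "\<And>\<F>. finite \<F> \<Longrightarrow> \<F> \<noteq> {} \<Longrightarrow> \<F> \<subseteq> B \<Longrightarrow> \<Inter>\<F> \<in> B"
    using X unfolding coherent_space_def by blast
  have Bop: "\<And>U. U \<in> B \<Longrightarrow> openin X U"
    and Bex: "\<And>U x. openin X U \<Longrightarrow> x \<in> U \<Longrightarrow> \<exists>V. V \<in> B \<and> x \<in> V \<and> V \<subseteq> U"
    using base unfolding openin_topology_base_unique by auto
  have Bsub: "\<And>U. U \<in> B \<Longrightarrow> U \<subseteq> topspace X" using Bop openin_subset by blast
  have inj: "inj_on f (topspace X)" and surj: "f ` topspace X = topspace Y"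
    and cont: "continuous_map X Y f"
    using f by (auto simp: homeomorphic_eq_everything_map)
  show ?thesis
    unfolding coherent_space_def
  proof (intro exI conjI)
    let ?B = "(`) f ` B"
    show "openin Y = arbitrary union_of (\<lambda>U. U \<in> ?B)"
      unfolding openin_topology_base_unique
    proof (intro conjI allI impI)
      show "openin Y V" if "V \<in> ?B" for V
        using that Bop Bsub homeomorphic_map_openness[OF f] by auto
      fix V y assume V: "openin Y V \<and> y \<in> V"
      then have "y \<in> topspace Y" using openin_subset by blast
      then obtain x where x: "x \<in> topspace X" "y = f x" using surj by blast
      have "openin X {x \<in> topspace X. f x \<in> V}"
        using cont V openin_continuous_map_preimage by blast
      then obtain U where "U \<in> B" "x \<in> U" "U \<subseteq> {x \<in> topspace X. f x \<in> V}"
        using Bex[of _ x] x V by blast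
      then show "\<exists>W. W \<in> ?B \<and> y \<in> W \<and> W \<subseteq> V" using x by blast
    qed
    show "\<forall>U \<in> ?B. compactin Y U"
      using comp Bsub homeomorphic_map_compactness[OF f] by auto
    show "\<forall>\<F>. finite \<F> \<and> \<F> \<noteq> {} \<and> \<F> \<subseteq> ?B \<longrightarrow> \<Inter>\<F> \<in> ?B"
    proof (intro allI impI)
      fix \<F> assume \<F>: "finite \<F> \<and> \<F> \<noteq> {} \<and> \<F> \<subseteq> ?B"
      then obtain \<C> where \<C>: "\<C> \<subseteq> B" "finite \<C>" "\<F> = (`) f ` \<C>"
        using finite_subset_image by metis
      have "\<C> \<noteq> {}" using \<C> \<F> by blast
      then obtain C where "C \<in> \<C>" by blast
      \<comment> \<open>Images commute with a non-empty intersection because \<open>f\<close> is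
        injective on the space; \<open>C\<close> witnesses non-emptiness.\<close>
      then have "f ` \<Inter>\<C> = \<Inter>\<F>"
        using image_INT[of f "topspace X" \<C> "\<lambda>U. U" C] inj Bsub \<C> by auto
      moreover have "\<Inter>\<C> \<in> B" using Int \<C> \<open>\<C> \<noteq> {}\<close> by blast
      ultimately show "\<Inter>\<F> \<in> ?B" by (metis imageI)
    qed
  qed
qed

text \<open>The property is pulled back from \<open>Y\<close> to \<open>X\<close>: a proper
  irreducible closed set is pushed forward, its image has a generic point, and the preimage of that
  point is generic for the original set.\<close>

lemma homeomorphic_map_almost_sober_space:
  assumes f: "homeomorphic_map X Y f" and Y: "almost_sober_space Y"
  shows "almost_sober_space X"
  unfolding almost_sober_space_def
proof (intro allI impI)
  have inj: "inj_on f (topspace X)" and surj: "f ` topspace X = topspace Y"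
    and cont: "continuous_map X Y f"
    using f by (auto simp: homeomorphic_eq_everything_map)
  fix F assume "irreducible_closedin X F \<and> F \<noteq> topspace X"
  then have Fne: "F \<noteq> {}" and Fcl: "closedin X F" and Fprop: "F \<noteq> topspace X"
    and Firr: "\<And>G H. closedin X G \<Longrightarrow> closedin X H \<Longrightarrow> F = G \<union> H \<Longrightarrow> F = G \<or> F = H"
    by (auto simp: irreducible_closedin_def)
  have Fsub: "F \<subseteq> topspace X" using Fcl closedin_subset by blast
  have "irreducible_closedin Y (f ` F)"
    unfolding irreducible_closedin_def
  proof (intro conjI allI impI)
    show "f ` F \<noteq> {}" "closedin Y (f ` F)"
      using Fne Fcl Fsub homeomorphic_map_closedness[OF f] by auto
    fix G H assume GH: "closedin Y G \<and> closedin Y H \<and> f ` F = G \<union> H"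
    define pre where "pre S = {x \<in> topspace X. f x \<in> S}" for S
    have "closedin X (pre G)" "closedin X (pre H)"
      using GH cont closedin_continuous_map_preimage by (auto simp: pre_def)
    moreover have "F = pre G \<union> pre H"
    proof -
      have "x \<in> F \<longleftrightarrow> f x \<in> f ` F" if "x \<in> topspace X" for x
        using inj_on_image_mem_iff[OF inj that Fsub] by simp
      then show ?thesis
        using GH Fsub unfolding pre_def by blast
    qed
    ultimately have "F = pre G \<or> F = pre H" using Firr by blast
    then show "f ` F = G \<or> f ` F = H"
      using GH unfolding pre_def by blast
  qed
  moreover have "f ` F \<noteq> topspace Y"
    using Fprop Fsub inj surj by (metis inj_on_image_eq_iff subset_refl)
  ultimately obtain y where y: "y \<in> topspace Y" "f ` F = Y closure_of {y}"
    using Y unfolding almost_sober_space_def by blast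
  then obtain x where x: "x \<in> topspace X" "y = f x" using surj by blast
  then have "f ` F = f ` (X closure_of {x})"
    using y homeomorphic_map_closure_of[OF f, of "{x}"] by simp
  then have "F = X closure_of {x}"
    using inj Fsub closure_of_subset_topspace by (metis inj_on_image_eq_iff)
  then show "\<exists>x \<in> topspace X. F = X closure_of {x}" using x by blast
qed

lemma balbes_dwinger_space_imp:
  assumes "balbes_dwinger_space TYPE('b) Z"
  shows "t0_space Z \<and> coherent_space Z \<and> almost_sober_space Z"
proof -
  obtain L :: "'b gorder" where L: "distributive_lattice L" and h: "Z homeomorphic_space prime_spectrum L"
    using assms unfolding balbes_dwinger_space_def by blast
  interpret distributive_lattice L by fact
  \<comment> \<open>Both directions are wanted: \<open>g\<close> pushes coherence from the spectrum
    to \<open>Z\<close>, while \<open>f\<close> pulls almost-soberness back.\<close>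
  obtain f g where "homeomorphic_map Z (prime_spectrum L) f" "homeomorphic_map (prime_spectrum L) Z g"
    using h homeomorphic_space homeomorphic_space_sym by metis
  then show ?thesis
    using homeomorphic_t0_space[OF h] t0_space_prime_spectrum
      homeomorphic_map_coherent_space coherent_space_prime_spectrum
      homeomorphic_map_almost_sober_space almost_sober_space_prime_spectrum by blast
qed

section \<open>The lattice of compact open sets\<close>

text \<open>Coherence speaks of some base. These two facts pass to the family of all compact open
  sets, which is determined by the topology alone.\<close>

lemma
  assumes "coherent_space Z"
  shows coherent_space_compact_open_base:
      "openin Z U \<Longrightarrow> x \<in> U \<Longrightarrow> \<exists>K. openin Z K \<and> compactin Z K \<and> x \<in> K \<and> K \<subseteq> U"
    and coherent_space_compactin_Int:
      "openin Z K \<Longrightarrow> compactin Z K \<Longrightarrow> openin Z M \<Longrightarrow> compactin Z M \<Longrightarrow> compactin Z (K \<inter> M)"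
proof -
  obtain B where base: "openin Z = arbitrary union_of (\<lambda>U. U \<in> B)"
    and comp: "\<And>U. U \<in> B \<Longrightarrow> compactin Z U"
    and Int: "\<And>\<F>. finite \<F> \<Longrightarrow> \<F> \<noteq> {} \<Longrightarrow> \<F> \<subseteq> B \<Longrightarrow> \<Inter>\<F> \<in> B"
    using assms unfolding coherent_space_def by blast
  have Bop: "\<And>U. U \<in> B \<Longrightarrow> openin Z U"
    and Bex: "\<And>U x. openin Z U \<Longrightarrow> x \<in> U \<Longrightarrow> \<exists>V. V \<in> B \<and> x \<in> V \<and> V \<subseteq> U"
    using base unfolding openin_topology_base_unique by auto
  show "\<exists>K. openin Z K \<and> compactin Z K \<and> x \<in> K \<and> K \<subseteq> U" if U: "openin Z U" "x \<in> U"
  proof -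
    obtain V where "V \<in> B" "x \<in> V" "V \<subseteq> U" using Bex[OF U] by blast
    then show ?thesis using Bop comp by blast
  qed
  \<comment> \<open>A compact open set is a finite union of base members, so an intersection of two
    such sets is a finite union of pairwise intersections of base members, each compact.\<close>
  have fin: "\<exists>\<F>. finite \<F> \<and> \<F> \<subseteq> B \<and> \<Union>\<F> = K" if K: "openin Z K" "compactin Z K" for K
  proof -
    let ?U = "{V \<in> B. V \<subseteq> K}"
    have "K \<subseteq> \<Union>?U" using Bex[OF K(1)] by blast
    then obtain \<F> where "finite \<F>" "\<F> \<subseteq> ?U" "K \<subseteq> \<Union>\<F>"
      using compactinD[OF K(2), of ?U] Bop by blast
    then show ?thesis by blast
  qed
  show "compactin Z (K \<inter> M)"
    if KM: "openin Z K" "compactin Z K" "openin Z M" "compactin Z M"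
  proof -
    obtain \<F> \<G> where \<F>: "finite \<F>" "\<F> \<subseteq> B" "\<Union>\<F> = K" and \<G>: "finite \<G>" "\<G> \<subseteq> B" "\<Union>\<G> = M"
      using fin KM by metis
    have BB: "compactin Z (U \<inter> V)" if "U \<in> B" "V \<in> B" for U V
      using Int[of "{U, V}"] comp that by simp
    have "K \<inter> M = \<Union>((\<lambda>(U, V). U \<inter> V) ` (\<F> \<times> \<G>))"
      using \<F>(3) \<G>(3) by auto
    moreover have "compactin Z (\<Union>((\<lambda>(U, V). U \<inter> V) ` (\<F> \<times> \<G>)))"
      using \<F> \<G> BB by (intro compactin_Union) auto
    ultimately show ?thesis by simp
  qed
qed

text \<open>The empty set is an element precisely when \<open>{{}}\<close> is not prime or corresponds to a generic point.\<close>

definition compact_open_sets :: "'a topology \<Rightarrow> 'a set set" where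
  "compact_open_sets Z = {K. openin Z K \<and> compactin Z K \<and>
     (K = {} \<and> irreducible_closedin Z (topspace Z) \<longrightarrow>
       (\<exists>x \<in> topspace Z. Z closure_of {x} = topspace Z))}"

definition compact_open_lattice :: "'a topology \<Rightarrow> 'a set gorder" where
  "compact_open_lattice Z = \<lparr>carrier = compact_open_sets Z, eq = (=), le = (\<subseteq>)\<rparr>"

lemma compact_open_lattice_simps [simp]:
  "carrier (compact_open_lattice Z) = compact_open_sets Z"
  "x \<sqsubseteq>\<^bsub>compact_open_lattice Z\<^esub> y \<longleftrightarrow> x \<subseteq> y"
  "x .=\<^bsub>compact_open_lattice Z\<^esub> y \<longleftrightarrow> x = y"
  by (simp_all add: compact_open_lattice_def)

text \<open>The complements of two disjoint non-empty open sets would be proper closed sets covering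
  the space. This keeps the lattice closed under intersections when \<open>{}\<close> is left
  out.\<close>

lemma irreducible_Int_nonempty:
  assumes "irreducible_closedin Z (topspace Z)" "openin Z K" "openin Z M" "K \<noteq> {}" "M \<noteq> {}"
  shows "K \<inter> M \<noteq> {}"
proof
  assume "K \<inter> M = {}"
  then have "topspace Z = (topspace Z - K) \<union> (topspace Z - M)" by blast
  moreover have "closedin Z (topspace Z - K)" "closedin Z (topspace Z - M)"
    using assms by auto
  ultimately have "topspace Z = topspace Z - K \<or> topspace Z = topspace Z - M"
    using assms(1) unfolding irreducible_closedin_def by meson
  then show False using assms openin_subset[of Z] by blast
qed

lemma compact_open_sets_Un:
  "K \<in> compact_open_sets Z \<Longrightarrow> M \<in> compact_open_sets Z \<Longrightarrow> K \<union> M \<in> compact_open_sets Z"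
  by (auto simp: compact_open_sets_def compactin_Un)

lemma compact_open_sets_Int:
  assumes "coherent_space Z" "K \<in> compact_open_sets Z" "M \<in> compact_open_sets Z"
  shows "K \<inter> M \<in> compact_open_sets Z"
  using assms coherent_space_compactin_Int[OF assms(1), of K M] irreducible_Int_nonempty[of Z K M]
  unfolding compact_open_sets_def by auto

lemma partial_order_compact_open_lattice: "partial_order (compact_open_lattice Z)"
  by unfold_locales (auto simp: compact_open_lattice_def)

lemma least_compact_open_lattice:
  assumes "K \<in> compact_open_sets Z" "M \<in> compact_open_sets Z"
  shows "least (compact_open_lattice Z) (K \<union> M) (Upper (compact_open_lattice Z) {K, M})"
  using assms compact_open_sets_Un[OF assms] by (auto simp: least_def Upper_def)

lemma greatest_compact_open_lattice:
  assumes "coherent_space Z" "K \<in> compact_open_sets Z" "M \<in> compact_open_sets Z"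
  shows "greatest (compact_open_lattice Z) (K \<inter> M) (Lower (compact_open_lattice Z) {K, M})"
  using assms compact_open_sets_Int[OF assms] by (auto simp: greatest_def Lower_def)

lemma lattice_compact_open_lattice:
  assumes "coherent_space Z"
  shows "lattice (compact_open_lattice Z)"
proof -
  interpret partial_order "compact_open_lattice Z" by (rule partial_order_compact_open_lattice)
  show ?thesis
  proof unfold_locales
    fix K M
    assume KM: "K \<in> carrier (compact_open_lattice Z)" "M \<in> carrier (compact_open_lattice Z)"
    show "\<exists>s. least (compact_open_lattice Z) s (Upper (compact_open_lattice Z) {K, M})"
      using least_compact_open_lattice KM by (intro exI) simp
    show "\<exists>s. greatest (compact_open_lattice Z) s (Lower (compact_open_lattice Z) {K, M})"
      using greatest_compact_open_lattice[OF assms] KM by (intro exI) simp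
  qed
qed

text \<open>The abstract operations choose some least upper or greatest lower bound; uniqueness of
  such bounds identifies the choice with the set operation.\<close>

lemma
  assumes "coherent_space Z" "K \<in> compact_open_sets Z" "M \<in> compact_open_sets Z"
  shows join_compact_open_lattice: "K \<squnion>\<^bsub>compact_open_lattice Z\<^esub> M = K \<union> M"
    and meet_compact_open_lattice: "K \<sqinter>\<^bsub>compact_open_lattice Z\<^esub> M = K \<inter> M"
proof -
  interpret lattice "compact_open_lattice Z" by (rule lattice_compact_open_lattice[OF assms(1)])
  show "K \<squnion>\<^bsub>compact_open_lattice Z\<^esub> M = K \<union> M"
    unfolding join_def
    using least_unique least_compact_open_lattice[OF assms(2,3)] assms(2,3) sup_of_two_least
    by (metis compact_open_lattice_simps(1))
  show "K \<sqinter>\<^bsub>compact_open_lattice Z\<^esub> M = K \<inter> M"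
    unfolding meet_def
    using greatest_unique greatest_compact_open_lattice[OF assms] assms(2,3) inf_of_two_greatest
    by (metis compact_open_lattice_simps(1))
qed

text \<open>Leaving out \<open>{}\<close> does no harm here, since the base member found contains
  \<open>x\<close>.\<close>

lemma compact_open_sets_base:
  assumes "coherent_space Z" "openin Z U" "x \<in> U"
  shows "\<exists>K \<in> compact_open_sets Z. x \<in> K \<and> K \<subseteq> U"
  using coherent_space_compact_open_base[OF assms] by (auto simp: compact_open_sets_def)

lemma compact_open_sets_nonempty:
  assumes "coherent_space Z"
  shows "compact_open_sets Z \<noteq> {}"
proof (cases "topspace Z = {}")
  case True
  \<comment> \<open>An irreducible set is non-empty by definition, so for the empty space the
    condition on \<open>{}\<close> is vacuous and \<open>{}\<close> is a member.\<close>
  then show ?thesis by (auto simp: compact_open_sets_def irreducible_closedin_def)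
next
  case False
  then show ?thesis using compact_open_sets_base[OF assms openin_topspace] by blast
qed

lemma distributive_lattice_compact_open_lattice:
  assumes "coherent_space Z"
  shows "distributive_lattice (compact_open_lattice Z)"
proof -
  interpret lattice "compact_open_lattice Z" by (rule lattice_compact_open_lattice[OF assms])
  show ?thesis
    by unfold_locales
      (auto simp: compact_open_sets_nonempty assms join_compact_open_lattice
        meet_compact_open_lattice compact_open_sets_Un compact_open_sets_Int)
qed

section \<open>Points as prime ideals of the lattice of compact open sets\<close>

definition point_ideal :: "'a topology \<Rightarrow> 'a \<Rightarrow> 'a set set" where
  "point_ideal Z x = {K \<in> compact_open_sets Z. x \<notin> K}"

text \<open>The delicate point is that the ideal is non-empty. The remaining conditions are set
  algebra and the existence of a compact open neighbourhood of \<open>x\<close>.\<close>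

lemma prime_point_ideal:
  assumes coh: "coherent_space Z" and x: "x \<in> topspace Z"
  shows "lattice_prime_ideal (compact_open_lattice Z) (point_ideal Z x)"
  unfolding lattice_prime_ideal_def lattice_ideal_iff_join[OF lattice_compact_open_lattice[OF coh]]
proof (intro conjI ballI impI)
  obtain K where "K \<in> compact_open_sets Z" "x \<in> K"
    using compact_open_sets_base[OF coh openin_topspace x] by blast
  then show "point_ideal Z x \<noteq> carrier (compact_open_lattice Z)"
    by (auto simp: point_ideal_def)
  show "point_ideal Z x \<noteq> {}"
  \<comment> \<open>A generic point lies in every non-empty open set, so only \<open>{}\<close> can
    belong to its ideal; the lattice was defined to contain \<open>{}\<close> in that case.
    Otherwise a lattice member inside the complement of the closure works.\<close>
  proof (cases "Z closure_of {x} = topspace Z")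
    case True
    then have "{} \<in> compact_open_sets Z" using x by (auto simp: compact_open_sets_def)
    then show ?thesis by (auto simp: point_ideal_def)
  next
    case False
    then obtain y where y: "y \<in> topspace Z - Z closure_of {x}"
      using closure_of_subset_topspace[of Z "{x}"] by blast
    have "openin Z (topspace Z - Z closure_of {x})" by auto
    then obtain K where K: "K \<in> compact_open_sets Z" "K \<subseteq> topspace Z - Z closure_of {x}"
      using compact_open_sets_base[OF coh _ y] by blast
    have "x \<in> Z closure_of {x}" using x by (simp add: in_closure_of)
    then have "x \<notin> K" using K by blast
    then show ?thesis using K by (auto simp: point_ideal_def)
  qed
qed (auto simp: point_ideal_def coh join_compact_open_lattice meet_compact_open_lattice
        compact_open_sets_Un)

text \<open>The complement \<open>F\<close> of the union of \<open>I\<close> is irreducible because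
  \<open>I\<close> is prime, and a generic point of \<open>F\<close> is the required
  \<open>x\<close>. Compactness ensures that \<open>I\<close> can be recovered from its
  union.\<close>

lemma prime_ideal_is_point_ideal:
  assumes coh: "coherent_space Z" and sob: "almost_sober_space Z"
    and I: "lattice_prime_ideal (compact_open_lattice Z) I"
  shows "\<exists>x \<in> topspace Z. I = point_ideal Z x"
proof -
  have lat: "lattice (compact_open_lattice Z)" by (rule lattice_compact_open_lattice[OF coh])
  note I' = I[unfolded lattice_prime_ideal_def lattice_ideal_iff_join[OF lat], simplified]
  have Icar: "I \<subseteq> compact_open_sets Z" and Ine: "I \<noteq> {}" and Iprop: "I \<noteq> compact_open_sets Z"
    using I' by simp_all
  have Ilow: "M \<in> I" if "K \<in> I" "M \<in> compact_open_sets Z" "M \<subseteq> K" for K M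
    using I' that by blast
  have IUn: "K \<union> M \<in> I" if KM: "K \<in> I" "M \<in> I" for K M
  proof -
    have "K \<in> compact_open_sets Z" "M \<in> compact_open_sets Z" using Icar KM by auto
    moreover have "K \<squnion>\<^bsub>compact_open_lattice Z\<^esub> M \<in> I" using I' KM by blast
    ultimately show ?thesis by (simp add: join_compact_open_lattice[OF coh])
  qed
  have IInt: "K \<in> I \<or> M \<in> I"
    if KM: "K \<in> compact_open_sets Z" "M \<in> compact_open_sets Z" "K \<inter> M \<in> I" for K M
  proof -
    have "K \<sqinter>\<^bsub>compact_open_lattice Z\<^esub> M \<in> I"
      using KM by (simp add: meet_compact_open_lattice[OF coh])
    then show ?thesis using I' KM by blast
  qed
  have opI: "\<And>K. K \<in> compact_open_sets Z \<Longrightarrow> openin Z K"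
    by (simp add: compact_open_sets_def)
  have IopI: "openin Z K" if "K \<in> I" for K
    using opI[of K] that Icar by auto
  have UI: "openin Z (\<Union>I)"
    using IopI by (rule openin_Union)
  have fin_bound: "\<exists>M \<in> I. \<Union>\<F> \<subseteq> M" if "finite \<F>" "\<F> \<subseteq> I" for \<F>
    using that
  proof (induction \<F> rule: finite_induct)
    case empty
    then show ?case using Ine by auto
  next
    case (insert K \<F>)
    then obtain M where "M \<in> I" "\<Union>\<F> \<subseteq> M" by auto
    then show ?case using IUn[of K M] insert.prems by (intro bexI[of _ "K \<union> M"]) auto
  qed
  \<comment> \<open>Compactness leaves finitely many members of \<open>I\<close> covering
    \<open>K\<close>; their union lies below one member, and \<open>I\<close> is a lower
    set.\<close>
  have memI: "K \<in> I" if K: "K \<in> compact_open_sets Z" "K \<subseteq> \<Union>I" for K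
  proof -
    have "compactin Z K" using K by (simp add: compact_open_sets_def)
    then have "\<exists>\<F>. finite \<F> \<and> \<F> \<subseteq> I \<and> K \<subseteq> \<Union>\<F>"
      using IopI K(2) by (rule compactinD)
    then obtain \<F> where \<F>: "finite \<F>" "\<F> \<subseteq> I" "K \<subseteq> \<Union>\<F>"
      by blast
    obtain M where M: "M \<in> I" "\<Union>\<F> \<subseteq> M" using fin_bound[OF \<F>(1,2)] by (rule bexE)
    show ?thesis using M(1) K(1) order_trans[OF \<F>(3) M(2)] by (rule Ilow)
  qed
  define F where "F = topspace Z - \<Union>I"
  have Fcl: "closedin Z F" using UI by (simp add: F_def closedin_diff)
  have Fne: "F \<noteq> {}"
  proof -
    obtain K where K: "K \<in> compact_open_sets Z" "K \<notin> I" using Icar Iprop by blast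
    then obtain z where "z \<in> K" "z \<notin> \<Union>I" using memI[OF K(1)] K(2) by blast
    then show ?thesis using openin_subset[OF opI[OF K(1)]] by (auto simp: F_def)
  qed
  have Firr: "irreducible_closedin Z F"
    unfolding irreducible_closedin_def
  proof (intro conjI allI impI)
    show "F \<noteq> {}" "closedin Z F" by fact+
    fix G H assume GH: "closedin Z G \<and> closedin Z H \<and> F = G \<union> H"
    \<comment> \<open>A point of \<open>F\<close> outside \<open>A\<close> has a lattice
      neighbourhood missing \<open>A\<close>; as it meets \<open>F\<close>, it cannot belong to
      \<open>I\<close>.\<close>
    have ex: "\<exists>K \<in> compact_open_sets Z. K \<inter> A = {} \<and> K \<notin> I"
      if A: "closedin Z A" "A \<subseteq> F" "F \<noteq> A" for A
    proof -
      obtain z where z: "z \<in> F" "z \<notin> A" using A by blast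
      then have "z \<in> topspace Z - A" by (auto simp: F_def)
      then obtain K where K: "K \<in> compact_open_sets Z" "z \<in> K" "K \<subseteq> topspace Z - A"
        using compact_open_sets_base[OF coh _ \<open>z \<in> topspace Z - A\<close>] A(1)
        unfolding closedin_def by blast
      have "K \<notin> I" using K z by (auto simp: F_def)
      then show ?thesis using K by blast
    qed
    show "F = G \<or> F = H"
    proof (rule ccontr)
      assume "\<not> ?thesis"
      then obtain K M where KM: "K \<in> compact_open_sets Z" "K \<inter> G = {}" "K \<notin> I"
        "M \<in> compact_open_sets Z" "M \<inter> H = {}" "M \<notin> I"
        using ex[of G] ex[of H] GH by blast
      \<comment> \<open>Since \<open>F\<close> is covered by \<open>G\<close> and \<open>H\<close>,
        the intersection avoids \<open>F\<close> and so lies in \<open>I\<close>, although neither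
        factor does. This contradicts primeness.\<close>
      have "K \<inter> M \<inter> F = {}" using KM GH by blast
      then have "K \<inter> M \<subseteq> \<Union>I" using openin_subset[OF opI[OF KM(1)]] by (auto simp: F_def)
      then have "K \<inter> M \<in> I" using memI[OF compact_open_sets_Int[OF coh KM(1,4)]] by blast
      then show False using IInt[OF KM(1,4)] KM(3,6) by blast
    qed
  qed
  have "\<exists>x \<in> topspace Z. F = Z closure_of {x}"
  proof (cases "F = topspace Z")
    case True
    \<comment> \<open>Then \<open>I = {{}}\<close>, so \<open>{}\<close> belongs to the lattice, which provides a generic point.\<close>
    then have "\<Union>I = {}" using openin_subset[OF UI] by (auto simp: F_def)
    then have "{} \<in> compact_open_sets Z" using Ine Icar by fastforce
    then show ?thesis using True Firr by (auto simp: compact_open_sets_def)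
  next
    case False
    then show ?thesis using sob Firr unfolding almost_sober_space_def by blast
  qed
  then obtain x where x: "x \<in> topspace Z" "F = Z closure_of {x}" by blast
  have "K \<in> I \<longleftrightarrow> x \<notin> K" if K: "K \<in> compact_open_sets Z" for K
  proof
    have "x \<in> F" using x by (simp add: in_closure_of)
    then show "K \<in> I \<Longrightarrow> x \<notin> K" by (auto simp: F_def)
    assume "x \<notin> K"
    \<comment> \<open>An open set that misses \<open>x\<close> also misses the closure of
      \<open>{x}\<close>.\<close>
    then have "K \<inter> F = {}" using opI[OF K] x(2) by (auto simp: in_closure_of)
    then have "K \<subseteq> \<Union>I" using openin_subset[OF opI[OF K]] by (auto simp: F_def)
    then show "K \<in> I" using memI[OF K] by blast
  qed
  then have "I = point_ideal Z x" using Icar by (auto simp: point_ideal_def)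
  then show ?thesis using x by blast
qed

text \<open>Injectivity comes from \<open>T_0\<close> and surjectivity from almost-soberness. The
  fact \<open>basic\<close> matches each \<open>K\<close> with its basic open set in the spectrum,
  which gives openness and continuity by comparing bases.\<close>

lemma homeomorphic_map_point_ideal:
  assumes t0: "t0_space Z" and coh: "coherent_space Z" and sob: "almost_sober_space Z"
  shows "homeomorphic_map Z (prime_spectrum (compact_open_lattice Z)) (point_ideal Z)"
proof -
  let ?L = "compact_open_lattice Z"
  interpret lattice ?L by (rule lattice_compact_open_lattice[OF coh])
  have opI: "\<And>K. K \<in> compact_open_sets Z \<Longrightarrow> openin Z K"
    by (simp add: compact_open_sets_def)
  have basic: "point_ideal Z x \<in> spectrum_basic ?L K \<longleftrightarrow> x \<in> K"
    if "x \<in> topspace Z" "K \<in> compact_open_sets Z" for x K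
    using that prime_point_ideal[OF coh] by (auto simp: spectrum_basic_def point_ideal_def)
  have surj: "point_ideal Z ` topspace Z = topspace (prime_spectrum ?L)"
    unfolding topspace_prime_spectrum[OF lattice_axioms]
    using prime_point_ideal[OF coh] prime_ideal_is_point_ideal[OF coh sob] by blast
  show ?thesis
  proof (rule bijective_open_imp_homeomorphic_map)
    show "point_ideal Z ` topspace Z = topspace (prime_spectrum ?L)" by (rule surj)
    show "inj_on (point_ideal Z) (topspace Z)"
    proof (rule inj_onI, rule ccontr)
      fix x y assume xy: "x \<in> topspace Z" "y \<in> topspace Z" "point_ideal Z x = point_ideal Z y" "x \<noteq> y"
      then obtain U where U: "openin Z U" "x \<notin> U \<longleftrightarrow> y \<in> U"
        using t0 unfolding t0_space_def by blast
      have same: "x \<in> K \<longleftrightarrow> y \<in> K" if "K \<in> compact_open_sets Z" for K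
        using basic that xy by metis
      show False
        using compact_open_sets_base[OF coh U(1), of x] compact_open_sets_base[OF coh U(1), of y]
          U(2) same by blast
    qed
    show "open_map Z (prime_spectrum ?L) (point_ideal Z)"
      unfolding open_map_def
    proof (intro allI impI)
      fix U assume U: "openin Z U"
      show "openin (prime_spectrum ?L) (point_ideal Z ` U)"
      proof (subst openin_subopen, intro ballI)
        fix I assume "I \<in> point_ideal Z ` U"
        then obtain x where x: "x \<in> U" "I = point_ideal Z x" by blast
        then obtain K where K: "K \<in> compact_open_sets Z" "x \<in> K" "K \<subseteq> U"
          using compact_open_sets_base[OF coh U] by blast
        have "spectrum_basic ?L K \<subseteq> point_ideal Z ` K"
        proof
          fix P assume P: "P \<in> spectrum_basic ?L K"
          then obtain y where "y \<in> topspace Z" "P = point_ideal Z y"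
            using prime_ideal_is_point_ideal[OF coh sob, of P] by (auto simp: spectrum_basic_def)
          then show "P \<in> point_ideal Z ` K" using basic[OF _ K(1)] P by blast
        qed
        moreover have "I \<in> spectrum_basic ?L K"
          using basic[OF _ K(1)] x K openin_subset[OF U] by blast
        ultimately show "\<exists>T. openin (prime_spectrum ?L) T \<and> I \<in> T \<and> T \<subseteq> point_ideal Z ` U"
          using openin_spectrum_basic[of K] K by (intro exI[of _ "spectrum_basic ?L K"]) auto
      qed
    qed
    show "continuous_map Z (prime_spectrum ?L) (point_ideal Z)"
      unfolding continuous_map_def
    proof (intro conjI allI impI)
      show "point_ideal Z \<in> topspace Z \<rightarrow> topspace (prime_spectrum ?L)" using surj by blast
      fix V assume V: "openin (prime_spectrum ?L) V"
      show "openin Z {x \<in> topspace Z. point_ideal Z x \<in> V}"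
      proof (subst openin_subopen, intro ballI)
        fix x assume "x \<in> {x \<in> topspace Z. point_ideal Z x \<in> V}"
        then have x: "x \<in> topspace Z" "point_ideal Z x \<in> V" by auto
        then obtain K where K: "K \<in> compact_open_sets Z" "point_ideal Z x \<in> spectrum_basic ?L K"
          "spectrum_basic ?L K \<subseteq> V"
          using prime_spectrum_baseE[OF V] by auto
        have "K \<subseteq> {x \<in> topspace Z. point_ideal Z x \<in> V}"
          using K basic[OF _ K(1)] openin_subset[OF opI[OF K(1)]] by blast
        then show "\<exists>T. openin Z T \<and> x \<in> T \<and> T \<subseteq> {x \<in> topspace Z. point_ideal Z x \<in> V}"
          using K basic[OF x(1) K(1)] opI by blast
      qed
    qed
  qed
qed

text \<open>The lattice built from \<open>Z\<close> consists of subsets of \<open>Z\<close>, so the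
  type \<open>'a set\<close> accommodates it. The second conjunct, for arbitrary \<open>'b\<close>,
  shows that lattices over other types represent no further spaces.\<close>

theorem theorem10:
  fixes Z :: "'a topology"
  shows "(t0_space Z \<and> coherent_space Z \<and> almost_sober_space Z
            \<longleftrightarrow> balbes_dwinger_space TYPE('a set) Z) \<and>
         (balbes_dwinger_space TYPE('b) Z
            \<longrightarrow> t0_space Z \<and> coherent_space Z \<and> almost_sober_space Z)"
proof (intro conjI iffI impI)
  assume Z: "t0_space Z \<and> coherent_space Z \<and> almost_sober_space Z"
  then have "Z homeomorphic_space prime_spectrum (compact_open_lattice Z)"
    using homeomorphic_map_point_ideal homeomorphic_map_imp_homeomorphic_space by blast
  then show "balbes_dwinger_space TYPE('a set) Z"
    using Z distributive_lattice_compact_open_lattice unfolding balbes_dwinger_space_def by blast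
qed (use balbes_dwinger_space_imp in blast)+

end
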